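(* Let $\mathcal{G}$ be the set of all graphs, and for a graph $G$ let $\eta(G)$ be the maximum size of a clique disjoint edge set in $G$. Then the map $\eta:\mathcal{G}\longrightarrow\mathbb{N}_0$, $G\mapsto\eta(G)$, is compatible.
   Context: All graphs are finite and simple (undirected, no loops, no multiple edges), with an arbitrary finite vertex set; the graph with no vertices is allowed. $\mathbb{N}_0$ denotes the set of non-negative integers. Clique disjoint edge sets. A set $\mathcal{H}\subseteq E(G)$ is a clique disjoint edge set in $G$ if no two (distinct) elements of $\mathcal{H}$ belong to a common clique of $G$, i.e. there are no two distinct edges $e,e'\in\mathcal{H}$ and no set $C\subseteq V(G)$ of pairwise adjacent vertices with $e\cup e'\subseteq C$. Then $\eta(G)=\max\{|\mathcal{H}| : \mathcal{H}\text{ is a clique disjoint edge set in }G\}$. Notation for graphs. $K_t$ is the complete graph on $t$ vertices, and $\dot{\cup}$ denotes disjoint union of graphs. $\widehat{G}$ is the induced subgraph of $G$ obtained by deleting all isolated vertices of $G$. For $v\in V(G)$, $G-v$ is the induced subgraph of $G$ on $V(G)\setminus\{v\}$, $N_G(v)$ is the set of neighbours of $v$ in $G$, and $G_v$ is the graph with vertex set $V(G)$ and edge set $E(G)\cup\{\{u,w\} : \{u,w\}\subseteq N_G(v),\ u\neq w\}$. Compatible map. A map $\varphi:\mathcal{G}\to\mathbb{N}_0$ is called compatible if it satisfies the following three conditions: (a) $\varphi(\widehat{G})\leq\varphi(G)$ for every $G\in\mathcal{G}$; (b) if $G=\dot{\cup}_{i=1}^{t}K_{n_i}$ with $n_i\geq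 2$ for every $1\leq i\leq t$, then $\varphi(G)\geq t$; (c) if $G$ is not a disjoint union of complete graphs (where components that are single vertices $K_1$ are allowed in such a union), then there exists $v\in V(G)$ such that both (1) $\varphi(G-v)\leq\varphi(G)$ and (2) $\varphi(G_v)<\varphi(G)$. *)

theory Defs
  imports Main "HOL-Library.Disjoint_Sets"
begin

datatype 'a pregraph = Graph (verts: "'a set") (edges: "'a set set")

text \<open>The finite simple graphs with vertices in \<^typ>\<open>'a\<close>; edges are two-element
  vertex sets, and the graph without vertices is included.\<close>

definition graphs :: "'a pregraph set" where
  "graphs = {G. finite (verts G) \<and> (\<forall>e\<in>edges G. e \<subseteq> verts G \<and> card e = 2)}"

definition adjacent :: "'a pregraph \<Rightarrow> 'a \<Rightarrow> 'a \<Rightarrow> bool" where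
  "adjacent G u w \<longleftrightarrow> {u, w} \<in> edges G"

definition neighbours :: "'a pregraph \<Rightarrow> 'a \<Rightarrow> 'a set" where
  "neighbours G v = {u \<in> verts G. adjacent G v u}"

definition induced :: "'a pregraph \<Rightarrow> 'a set \<Rightarrow> 'a pregraph" where
  "induced G W = Graph (verts G \<inter> W) {e \<in> edges G. e \<subseteq> W}"

definition isolated :: "'a pregraph \<Rightarrow> 'a \<Rightarrow> bool" where
  "isolated G v \<longleftrightarrow> v \<in> verts G \<and> neighbours G v = {}"

definition delete_isolated :: "'a pregraph \<Rightarrow> 'a pregraph" where
  "delete_isolated G = induced G {v \<in> verts G. \<not> isolated G v}"

definition delete_vertex :: "'a pregraph \<Rightarrow> 'a \<Rightarrow> 'a pregraph" where
  "delete_vertex G v = induced G (verts G - {v})"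

text \<open>The graph $G_v$.\<close>

definition complete_nbhd :: "'a pregraph \<Rightarrow> 'a \<Rightarrow> 'a pregraph" where
  "complete_nbhd G v = Graph (verts G)
     (edges G \<union> {{u, w} | u w. {u, w} \<subseteq> neighbours G v \<and> u \<noteq> w})"

definition clique :: "'a pregraph \<Rightarrow> 'a set \<Rightarrow> bool" where
  "clique G C \<longleftrightarrow> C \<subseteq> verts G \<and> (\<forall>u\<in>C. \<forall>w\<in>C. u \<noteq> w \<longrightarrow> adjacent G u w)"

definition clique_disjoint :: "'a pregraph \<Rightarrow> 'a set set \<Rightarrow> bool" where
  "clique_disjoint G H \<longleftrightarrow> H \<subseteq> edges G \<and>
     \<not> (\<exists>e\<in>H. \<exists>e'\<in>H. e \<noteq> e' \<and> (\<exists>C. clique G C \<and> e \<union> e' \<subseteq> C))"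

definition eta :: "'a pregraph \<Rightarrow> nat" where
  "eta G = Max {card H | H. clique_disjoint G H}"

text \<open>\<open>is_complete n G\<close>: the graph \<open>G\<close> is a copy of $K_n$.\<close>

definition is_complete :: "nat \<Rightarrow> 'a pregraph \<Rightarrow> bool" where
  "is_complete n G \<longleftrightarrow> G \<in> graphs \<and> card (verts G) = n \<and>
     (\<forall>u\<in>verts G. \<forall>w\<in>verts G. u \<noteq> w \<longrightarrow> adjacent G u w)"

definition is_disjoint_union :: "'a pregraph \<Rightarrow> 'i set \<Rightarrow> ('i \<Rightarrow> 'a pregraph) \<Rightarrow> bool" where
  "is_disjoint_union G I F \<longleftrightarrow> disjoint_family_on (\<lambda>i. verts (F i)) I \<and>
     verts G = (\<Union>i\<in>I. verts (F i)) \<and> edges G = (\<Union>i\<in>I. edges (F i))"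

text \<open>\<open>is_union_of_complete G t n\<close>: up to isomorphism, \<open>G\<close> is the disjoint union of
  $K_{n_1}, \dots, K_{n_t}$. Since the \<open>F i\<close> below are copies of the $K_{n_i}$ inside \<open>G\<close>,
  no explicit isomorphism is needed.\<close>

definition is_union_of_complete :: "'a pregraph \<Rightarrow> nat \<Rightarrow> (nat \<Rightarrow> nat) \<Rightarrow> bool" where
  "is_union_of_complete G t n \<longleftrightarrow>
     (\<exists>F. (\<forall>i\<in>{1..t}. is_complete (n i) (F i)) \<and> is_disjoint_union G {1..t} F)"

text \<open>A map on the set of all graphs is a function on \<^typ>\<open>'a pregraph\<close> of which only
  the values on \<^const>\<open>graphs\<close> matter.\<close>

definition compatible :: "('a pregraph \<Rightarrow> nat) \<Rightarrow> bool" where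
  "compatible \<phi> \<longleftrightarrow>
     (\<forall>G\<in>graphs. \<phi> (delete_isolated G) \<le> \<phi> G) \<and>
     (\<forall>G\<in>graphs. \<forall>t n. is_union_of_complete G t n \<and> (\<forall>i\<in>{1..t}. n i \<ge> 2) \<longrightarrow> \<phi> G \<ge> t) \<and>
     (\<forall>G\<in>graphs. \<not> (\<exists>t n. is_union_of_complete G t n \<and> (\<forall>i\<in>{1..t}. n i \<ge> 1)) \<longrightarrow>
        (\<exists>v\<in>verts G. \<phi> (delete_vertex G v) \<le> \<phi> G \<and> \<phi> (complete_nbhd G v) < \<phi> G))"

text \<open>The constructions stay within \<^const>\<open>graphs\<close>, and the maximum defining
  \<^const>\<open>eta\<close> is attained.\<close>

lemma induced_in_graphs: "G \<in> graphs \<Longrightarrow> induced G W \<in> graphs"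
  by (auto simp: graphs_def induced_def)

lemma delete_isolated_in_graphs: "G \<in> graphs \<Longrightarrow> delete_isolated G \<in> graphs"
  by (simp add: delete_isolated_def induced_in_graphs)

lemma delete_vertex_in_graphs: "G \<in> graphs \<Longrightarrow> delete_vertex G v \<in> graphs"
  by (simp add: delete_vertex_def induced_in_graphs)

lemma complete_nbhd_in_graphs: "G \<in> graphs \<Longrightarrow> complete_nbhd G v \<in> graphs"
  by (auto simp: graphs_def complete_nbhd_def neighbours_def card_2_iff)

lemma finite_edges: "G \<in> graphs \<Longrightarrow> finite (edges G)"
  by (rule finite_subset[of _ "Pow (verts G)"]) (auto simp: graphs_def)

lemma eta_attained:
  assumes "G \<in> graphs"
  shows "\<exists>H. clique_disjoint G H \<and> card H = eta G"
    and "clique_disjoint G H \<Longrightarrow> card H \<le> eta G"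
proof -
  let ?S = "{card H | H. clique_disjoint G H}"
  have "?S \<subseteq> card ` Pow (edges G)"
    by (auto simp: clique_disjoint_def)
  then have fin: "finite ?S"
    using finite_edges[OF assms] by (meson finite_Pow_iff finite_imageI finite_subset)
  have "clique_disjoint G {}"
    by (simp add: clique_disjoint_def)
  then have "?S \<noteq> {}"
    by blast
  then have "eta G \<in> ?S"
    unfolding eta_def using fin by (rule Max_in[rotated])
  then show "\<exists>H. clique_disjoint G H \<and> card H = eta G"
    by force
  show "card H \<le> eta G" if "clique_disjoint G H"
    unfolding eta_def using fin that by (intro Max_ge) auto
qed

end

theory Submission
  imports Defs
begin

text \<open>
  Two edges lie in a common clique iff their union is itself a clique. Clique disjointness is
  therefore a condition on pairs of edges which an induced subgraph and its ambient graph decide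
  alike, so that \<^const>\<open>eta\<close> is monotone under induced subgraphs; this covers every
  comparison of \<open>G\<close> with a graph obtained by deleting vertices. In a disjoint union of
  complete graphs with at least two vertices each, one edge from every component gives a clique
  disjoint edge set.

  The substance is the strict inequality for \<open>G\<^sub>v\<close>. A graph that is not a disjoint union of
  complete graphs contains an induced path \<open>u - v - w\<close>, since otherwise adjacency is
  transitive and its classes are complete components. For the middle vertex \<open>v\<close>, take a
  largest clique disjoint edge set \<open>H\<close> of \<open>G\<^sub>v\<close>. The closed neighbourhood \<open>N[v]\<close> is
  a clique of \<open>G\<^sub>v\<close>, so at most one edge of \<open>H\<close> lies inside it. Replace this edge by the
  two edges \<open>uv\<close> and \<open>vw\<close> of \<open>G\<close>: they are clique disjoint because \<open>u\<close> and \<open>w\<close> are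
  not adjacent, and neither shares a clique of \<open>G\<close> with an edge that leaves \<open>N[v]\<close>, because
  every clique through \<open>v\<close> lies in \<open>N[v]\<close>. So \<open>G\<close> has a clique disjoint edge set with
  more elements than \<open>H\<close>.
\<close>

section \<open>Clique disjointness as a condition on pairs\<close>

lemma edge_cases:
  assumes "G \<in> graphs" "e \<in> edges G"
  obtains a b where "e = {a, b}" "a \<noteq> b" "a \<in> verts G" "b \<in> verts G" "adjacent G a b"
proof -
  from assms have "card e = 2" "e \<subseteq> verts G"
    by (auto simp: graphs_def)
  then obtain a b where ab: "e = {a, b}" "a \<noteq> b"
    unfolding card_2_iff by blast
  with \<open>e \<subseteq> verts G\<close> \<open>e \<in> edges G\<close>
  have "a \<in> verts G" "b \<in> verts G" "adjacent G a b"
    by (auto simp: adjacent_def)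
  with ab show thesis
    by (rule that)
qed

lemma adjacent_sym: "adjacent G a b \<Longrightarrow> adjacent G b a"
  by (simp add: adjacent_def insert_commute)

lemma adjacentD:
  assumes "G \<in> graphs" "adjacent G a b"
  shows "a \<noteq> b" "a \<in> verts G" "b \<in> verts G"
proof -
  have "card {a, b} = 2" "{a, b} \<subseteq> verts G"
    using assms unfolding graphs_def adjacent_def by blast+
  then show "a \<noteq> b" "a \<in> verts G" "b \<in> verts G"
    by auto
qed

lemma clique_subset: "clique G C \<Longrightarrow> D \<subseteq> C \<Longrightarrow> clique G D"
  unfolding clique_def by blast

text \<open>Any clique containing both edges may be shrunk to their union.\<close>

lemma clique_disjoint_iff:
  "clique_disjoint G H \<longleftrightarrow>
     H \<subseteq> edges G \<and> (\<forall>e\<in>H. \<forall>e'\<in>H. e \<noteq> e' \<longrightarrow> \<not> clique G (e \<union> e'))"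
proof -
  have *: "(\<exists>C. clique G C \<and> e \<union> e' \<subseteq> C) \<longleftrightarrow> clique G (e \<union> e')" for e e'
    by (metis clique_subset order_refl)
  show ?thesis
    unfolding clique_disjoint_def * by blast
qed

lemma clique_disjoint_finite:
  assumes "G \<in> graphs" "clique_disjoint G H"
  shows "finite H"
proof (rule finite_subset)
  show "H \<subseteq> edges G"
    using assms(2) by (simp add: clique_disjoint_def)
  show "finite (edges G)"
    by (rule finite_edges[OF assms(1)])
qed

text \<open>An induced subgraph keeps every adjacency between its vertices, hence it inherits all
  cliques of \<open>G\<close> on those vertices and imposes no weaker condition on its edge sets.\<close>

lemma eta_induced_le:
  assumes G: "G \<in> graphs"
  shows "eta (induced G W) \<le> eta G"
proof -
  obtain H where H: "clique_disjoint (induced G W) H" "card H = eta (induced G W)"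
    using eta_attained(1)[OF induced_in_graphs[OF G]] by blast
  have "\<not> clique G (e \<union> e')" if "e \<in> H" "e' \<in> H" "e \<noteq> e'" for e e'
  proof
    assume "clique G (e \<union> e')"
    moreover have "e \<union> e' \<subseteq> W"
      using H(1) that by (auto simp: clique_disjoint_iff induced_def)
    ultimately have "clique (induced G W) (e \<union> e')"
      unfolding clique_def induced_def adjacent_def by auto
    with H(1) that show False
      unfolding clique_disjoint_iff by blast
  qed
  moreover have "H \<subseteq> edges G"
    using H(1) by (auto simp: clique_disjoint_iff induced_def)
  ultimately have "clique_disjoint G H"
    unfolding clique_disjoint_iff by blast
  then show ?thesis
    using eta_attained(2)[OF G, of H] H(2) by simp
qed

section \<open>Disjoint unions of complete graphs\<close>

lemma eta_union_of_complete_ge: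
  assumes G: "G \<in> graphs" and U: "is_union_of_complete G t n"
    and n: "\<forall>i\<in>{1..t}. n i \<ge> 2"
  shows "t \<le> eta G"
proof -
  obtain F where F: "\<forall>i\<in>{1..t}. is_complete (n i) (F i)" "is_disjoint_union G {1..t} F"
    using U unfolding is_union_of_complete_def by blast
  have "\<exists>e. e \<in> edges (F i)" if "i \<in> {1..t}" for i
  proof -
    from F(1) that have c: "is_complete (n i) (F i)" by blast
    with n that have "card (verts (F i)) \<ge> 2"
      by (simp add: is_complete_def)
    then obtain T where "T \<subseteq> verts (F i)" "card T = 2"
      using obtain_subset_with_card_n by blast
    then obtain a b where "a \<in> verts (F i)" "b \<in> verts (F i)" "a \<noteq> b"
      by (auto simp: card_2_iff)
    with c show ?thesis
      unfolding is_complete_def adjacent_def by blast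
  qed
  then obtain e where e: "\<And>i. i \<in> {1..t} \<Longrightarrow> e i \<in> edges (F i)"
    by metis
  have Fg: "F i \<in> graphs" if "i \<in> {1..t}" for i
    using F(1) that unfolding is_complete_def by blast
  have disj: "verts (F i) \<inter> verts (F j) = {}" if "i \<in> {1..t}" "j \<in> {1..t}" "i \<noteq> j" for i j
    using F(2) that unfolding is_disjoint_union_def disjoint_family_on_def by blast
  have not_clique: "\<not> clique G (e i \<union> e j)"
    if ij: "i \<in> {1..t}" "j \<in> {1..t}" "i \<noteq> j" for i j
  proof
    assume cl: "clique G (e i \<union> e j)"
    obtain a where a: "a \<in> e i" "a \<in> verts (F i)"
      using edge_cases[OF Fg[OF ij(1)] e[OF ij(1)]] by blast
    obtain b where b: "b \<in> e j" "b \<in> verts (F j)"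
      using edge_cases[OF Fg[OF ij(2)] e[OF ij(2)]] by blast
    have "a \<noteq> b" using a b disj[OF ij] by blast
    with cl a b have "{a, b} \<in> edges G"
      unfolding clique_def adjacent_def by blast
    then obtain k where k: "k \<in> {1..t}" "{a, b} \<in> edges (F k)"
      using F(2) unfolding is_disjoint_union_def by blast
    then have "a \<in> verts (F k)" "b \<in> verts (F k)"
      using Fg[of k] unfolding graphs_def by auto
    with a b k(1) have "k = i" "k = j"
      using disj ij by blast+
    with ij show False by simp
  qed
  have inj: "inj_on e {1..t}"
  proof (rule inj_onI, rule ccontr)
    fix i j assume ij: "i \<in> {1..t}" "j \<in> {1..t}" "e i = e j" "i \<noteq> j"
    then have "e i \<subseteq> verts (F i)" "e i \<subseteq> verts (F j)" "card (e i) = 2"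
      using e[of i] e[of j] Fg[of i] Fg[of j] by (auto simp: graphs_def)
    with disj[of i j] ij have "e i = {}" by blast
    with \<open>card (e i) = 2\<close> show False by simp
  qed
  have "e ` {1..t} \<subseteq> edges G"
    using e F(2) unfolding is_disjoint_union_def by blast
  then have "clique_disjoint G (e ` {1..t})"
    unfolding clique_disjoint_iff using not_clique by blast
  then have "card (e ` {1..t}) \<le> eta G"
    by (rule eta_attained(2)[OF G])
  then show ?thesis
    unfolding card_image[OF inj] by simp
qed

text \<open>Without an induced path on three vertices, being equal or adjacent is an equivalence
  relation, and the closed neighbourhoods are its classes.\<close>

lemma union_of_complete_if_no_induced_path:
  assumes G: "G \<in> graphs"
    and tr: "\<And>u v w. adjacent G v u \<Longrightarrow> adjacent G v w \<Longrightarrow> u \<noteq> w \<Longrightarrow> adjacent G u w"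
  shows "\<exists>t n. is_union_of_complete G t n \<and> (\<forall>i\<in>{1..t}. n i \<ge> 1)"
proof -
  define cls where "cls x = insert x (neighbours G x)" for x
  define P where "P = cls ` verts G"
  have mem_cls: "y \<in> cls x \<longleftrightarrow> y = x \<or> adjacent G x y" for x y
    using adjacentD(3)[OF G] by (auto simp: cls_def neighbours_def)
  have cls_sub: "cls x \<subseteq> cls y" if "y \<in> cls x" for x y
  proof
    fix z assume "z \<in> cls x"
    with that tr[of x y z] adjacent_sym[of G x y] show "z \<in> cls y"
      unfolding mem_cls by blast
  qed
  have cls_eq: "cls x = cls y" if "y \<in> cls x" for x y
  proof -
    have "x \<in> cls y"
      using that adjacent_sym[of G x y] unfolding mem_cls by blast
    with that show ?thesis
      using cls_sub by blast
  qed
  have "finite P"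
    using G by (simp add: P_def graphs_def)
  then obtain h where h: "bij_betw h {1..card P} P"
    using ex_bij_betw_nat_finite_1 by blast
  define F where "F i = induced G (h i)" for i
  have hP: "\<exists>x\<in>verts G. h i = cls x" if "i \<in> {1..card P}" for i
    using h that unfolding bij_betw_def P_def by blast
  have vF: "verts (F i) = h i" if "i \<in> {1..card P}" for i
    using hP[OF that] by (auto simp: F_def induced_def cls_def neighbours_def)
  have "is_complete (card (h i)) (F i)" if i: "i \<in> {1..card P}" for i
  proof -
    have "adjacent G a b" if ab: "a \<in> h i" "b \<in> h i" "a \<noteq> b" for a b
    proof -
      obtain x where x: "x \<in> verts G" "h i = cls x"
        using hP[OF i] by blast
      with ab cls_eq[of a x] have "b \<in> cls a" by simp
      with ab show ?thesis by (simp add: mem_cls)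
    qed
    moreover have "F i \<in> graphs"
      by (simp add: F_def G induced_in_graphs)
    ultimately show ?thesis
      unfolding is_complete_def vF[OF i] by (simp add: adjacent_def F_def induced_def)
  qed
  moreover have "is_disjoint_union G {1..card P} F"
    unfolding is_disjoint_union_def disjoint_family_on_def
  proof (intro conjI ballI impI)
    fix i j assume ij: "i \<in> {1..card P}" "j \<in> {1..card P}" "i \<noteq> j"
    have "h i \<noteq> h j"
      using h ij unfolding bij_betw_def inj_on_def by blast
    moreover obtain x where "h i = cls x"
      using hP[OF ij(1)] by (elim bexE)
    moreover obtain y where "h j = cls y"
      using hP[OF ij(2)] by (elim bexE)
    ultimately have "\<not> (z \<in> h i \<and> z \<in> h j)" for z
      using cls_eq[of z x] cls_eq[of z y] by auto
    then have "h i \<inter> h j = {}"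
      by (simp add: disjoint_iff)
    then show "verts (F i) \<inter> verts (F j) = {}"
      using vF ij by simp
  next
    have "h ` {1..card P} = cls ` verts G"
      using h unfolding bij_betw_def P_def by blast
    moreover have "(\<Union>x\<in>verts G. cls x) = verts G"
      by (auto simp: cls_def neighbours_def)
    ultimately show "verts G = (\<Union>i\<in>{1..card P}. verts (F i))"
      using vF by simp
  next
    show "edges G = (\<Union>i\<in>{1..card P}. edges (F i))"
    proof
      show "edges G \<subseteq> (\<Union>i\<in>{1..card P}. edges (F i))"
      proof
        fix e assume e: "e \<in> edges G"
        then obtain a b where ab: "e = {a, b}" "a \<in> verts G" "b \<in> verts G" "adjacent G a b"
          using edge_cases[OF G e] by blast
        then have "cls a \<in> P" "e \<subseteq> cls a"
          by (auto simp: P_def mem_cls)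
        moreover obtain i where "i \<in> {1..card P}" "h i = cls a"
          using h \<open>cls a \<in> P\<close> unfolding bij_betw_def by (metis imageE)
        ultimately have "i \<in> {1..card P}" "e \<in> edges (F i)"
          using e by (simp_all add: F_def induced_def)
        then show "e \<in> (\<Union>i\<in>{1..card P}. edges (F i))"
          by (rule UN_I)
      qed
    qed (auto simp: F_def induced_def)
  qed
  ultimately have "is_union_of_complete G (card P) (\<lambda>i. card (h i))"
    unfolding is_union_of_complete_def by blast
  moreover have "card (h i) \<ge> 1" if i: "i \<in> {1..card P}" for i
  proof -
    obtain x where "x \<in> verts G" "h i = cls x"
      using hP[OF i] by blast
    moreover have "finite (verts G)"
      using G by (simp add: graphs_def)
    ultimately have "finite (h i)" "h i \<noteq> {}"
      by (auto simp: cls_def neighbours_def)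
    then show ?thesis
      by (simp add: Suc_le_eq card_gt_0_iff)
  qed
  ultimately show ?thesis by blast
qed

section \<open>Completing the neighbourhood of a vertex\<close>

lemma clique_complete_nbhd:
  "clique G C \<Longrightarrow> clique (complete_nbhd G v) C"
  by (simp add: clique_def complete_nbhd_def adjacent_def)

lemma closed_nbhd_clique:
  assumes "v \<in> verts G"
  shows "clique (complete_nbhd G v) (insert v (neighbours G v))"
proof -
  have "adjacent (complete_nbhd G v) a b"
    if "a \<in> neighbours G v" "b \<in> neighbours G v" "a \<noteq> b" for a b
    using that unfolding adjacent_def complete_nbhd_def by auto
  moreover have "adjacent (complete_nbhd G v) v a" if "a \<in> neighbours G v" for a
    using that by (simp add: adjacent_def complete_nbhd_def neighbours_def)
  moreover have "insert v (neighbours G v) \<subseteq> verts (complete_nbhd G v)"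
    using assms by (auto simp: complete_nbhd_def neighbours_def)
  ultimately show ?thesis
    unfolding clique_def using adjacent_sym by (metis insertE)
qed

lemma clique_through_vertex:
  assumes "clique G C" "v \<in> C"
  shows "C \<subseteq> insert v (neighbours G v)"
  using assms by (auto simp: clique_def neighbours_def)

text \<open>The exchange: inside the closed neighbourhood of \<open>v\<close>, the single edge that
  \<open>G\<^sub>v\<close> can afford is traded for the two edges of the induced path \<open>u - v - w\<close>.\<close>

lemma eta_complete_nbhd_less:
  assumes G: "G \<in> graphs" and vu: "adjacent G v u" and vw: "adjacent G v w"
    and uw: "u \<noteq> w" "\<not> adjacent G u w"
  shows "eta (complete_nbhd G v) < eta G"
proof -
  let ?Gv = "complete_nbhd G v" and ?N = "insert v (neighbours G v)"
  obtain H where H: "clique_disjoint ?Gv H" "card H = eta ?Gv"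
    using eta_attained(1)[OF complete_nbhd_in_graphs[OF G]] by blast
  have finH: "finite H"
    using clique_disjoint_finite[OF complete_nbhd_in_graphs[OF G] H(1)] .
  define A where "A = {e \<in> H. e \<subseteq> ?N}"
  define H' where "H' = insert {v, u} (insert {v, w} (H - A))"
  have v: "v \<in> verts G" and ne: "v \<noteq> u" "v \<noteq> w"
    using adjacentD[OF G vu] adjacentD[OF G vw] by auto
  have nb: "{v, u} \<subseteq> ?N" "{v, w} \<subseteq> ?N"
    using vu vw adjacentD[OF G] by (auto simp: neighbours_def)
  have "e = e'" if "e \<in> A" "e' \<in> A" for e e'
    using that H(1) clique_subset[OF closed_nbhd_clique[OF v], of "e \<union> e'"]
    unfolding A_def clique_disjoint_iff by blast
  then have "card A \<le> 1"
    using finH by (auto simp: A_def card_le_Suc0_iff_eq)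
  moreover have "card (H - A) = card H - card A" "card A \<le> card H"
    using finH by (auto simp: A_def intro!: card_Diff_subset card_mono)
  moreover have "card H' = card (H - A) + 2"
  proof -
    have "{v, u} \<notin> H - A" "{v, w} \<notin> H - A" "{v, u} \<noteq> {v, w}"
      using nb uw(1) ne by (auto simp: A_def doubleton_eq_iff)
    then show ?thesis
      using finH by (simp add: H'_def)
  qed
  ultimately have more: "card H < card H'"
    by linarith
  have old: "\<not> clique G (e \<union> e')" if "e \<in> H - A" "e' \<in> H - A" "e \<noteq> e'" for e e'
    using that H(1) clique_complete_nbhd[of G "e \<union> e'" v]
    unfolding clique_disjoint_iff by blast
  have mixed: "\<not> clique G (e \<union> e')" if "v \<in> e" "e' \<in> H - A" for e e'
    using that clique_through_vertex[of G "e \<union> e'" v] unfolding A_def by blast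
  have new: "\<not> clique G ({v, u} \<union> {v, w})"
    using uw by (auto simp: clique_def)
  have "\<not> clique G (e \<union> e')" if "e \<in> H'" "e' \<in> H'" "e \<noteq> e'" for e e'
  proof -
    have "e \<in> H - A \<or> e = {v, u} \<or> e = {v, w}" "e' \<in> H - A \<or> e' = {v, u} \<or> e' = {v, w}"
      using that(1,2) unfolding H'_def by blast+
    then show ?thesis
      using that(3) old mixed new by (metis Un_commute insertI1)
  qed
  moreover have "H' \<subseteq> edges G"
  proof -
    \<comment> \<open>The edges added in \<open>G\<^sub>v\<close> join neighbours of \<open>v\<close>, so they have been removed with \<open>A\<close>.\<close>
    have "e \<in> edges G" if "e \<in> H - A" for e
      using that H(1) unfolding clique_disjoint_iff A_def complete_nbhd_def by auto
    then show ?thesis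
      using vu vw by (auto simp: H'_def adjacent_def)
  qed
  ultimately have "clique_disjoint G H'"
    unfolding clique_disjoint_iff by blast
  then show ?thesis
    using eta_attained(2)[OF G, of H'] more H(2) by simp
qed

section \<open>Compatibility\<close>

theorem theorem2p5: "compatible (eta :: 'a pregraph \<Rightarrow> nat)"
  unfolding compatible_def
proof (intro conjI ballI allI impI)
  fix G :: "'a pregraph" assume G: "G \<in> graphs"
  show "eta (delete_isolated G) \<le> eta G"
    unfolding delete_isolated_def by (rule eta_induced_le[OF G])
  show "t \<le> eta G" if "is_union_of_complete G t n \<and> (\<forall>i\<in>{1..t}. 2 \<le> n i)" for t n
    using eta_union_of_complete_ge[OF G] that by blast
  assume "\<not> (\<exists>t n. is_union_of_complete G t n \<and> (\<forall>i\<in>{1..t}. 1 \<le> n i))"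
  then obtain u v w where
    path: "adjacent G v u" "adjacent G v w" "u \<noteq> w" "\<not> adjacent G u w"
    using union_of_complete_if_no_induced_path[OF G] by blast
  have "v \<in> verts G"
    using adjacentD[OF G path(1)] by blast
  moreover have "eta (delete_vertex G v) \<le> eta G"
    unfolding delete_vertex_def by (rule eta_induced_le[OF G])
  moreover have "eta (complete_nbhd G v) < eta G"
    by (rule eta_complete_nbhd_less[OF G path])
  ultimately show "\<exists>v\<in>verts G. eta (delete_vertex G v) \<le> eta G \<and> eta (complete_nbhd G v) < eta G"
    by blast
qed

end
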